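(* Let $A_\alpha := (A,\ast,\{,,\},\alpha)$ be a Hom-Lie-Yamaguti superalgebra and let $\beta$ be an even endomorphism of the superalgebra $(A,\ast,\{,,\})$ (that is, an even linear map $\beta: A\to A$ with $\beta(x\ast y)=\beta(x)\ast\beta(y)$ and $\beta(\{x,y,z\})=\{\beta(x),\beta(y),\beta(z)\}$ for all $x,y,z\in A$) such that $\beta\alpha=\alpha\beta$. Let $\beta^0=\mathrm{Id}$ and, for any $n\ge 1$, $\beta^n:=\beta\circ\beta^{n-1}$. For $n\geq 1$ define on $A$ the superoperations $$x\ast_\beta y := \beta^n(x\ast y),\qquad \{x,y,z\}_\beta := \beta^{2n}(\{x,y,z\})$$ for all $x,y,z\in A$. Then, for every $n\ge 1$, $A_{\beta^n} := (A,\ast_\beta,\{,,\}_\beta,\beta^n\alpha)$ is a Hom-Lie-Yamaguti superalgebra.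
   Context: $\mathbb{K}$ is a field. A $\mathbb{K}$-vector superspace is a $\mathbb{Z}_2$-graded vector space $L=L_0\oplus L_1$; $|x|\in\{0,1\}$ denotes the degree of a homogeneous element $x$. A linear map is even if it preserves the grading. A binary (resp. ternary) superoperation is a bilinear (resp. trilinear) map on $L$ respecting the grading. Identities involving signs are stated for homogeneous elements. $\circlearrowleft_{(x,y,z)}$ denotes the sum over cyclic permutations of $x,y,z$ (the sign factor is permuted as well). A Hom-Lie-Yamaguti superalgebra is a quadruple $(L,\ast,\{,,\},\alpha)$ in which $L$ is a $\mathbb{K}$-vector superspace, $\ast$ a binary superoperation and $\{,,\}$ a ternary superoperation on $L$, and $\alpha:L\to L$ an even linear map such that for all $u,v,w,x,y,z\in L$: (SHLY1) $\alpha(x\ast y)=\alpha(x)\ast\alpha(y)$; (SHLY2) $\alpha(\{x,y,z\})=\{\alpha(x),\alpha(y),\alpha(z)\}$; (SHLY3) $x\ast y=-(-1)^{|x||y|}y\ast x$; (SHLY4) $\{x,y,z\}=-(-1)^{|x||y|}\{y,x,z\}$; (SHLY5) $\circlearrowleft_{(x,y,z)}(-1)^{|x||z|}[(x\ast y)\ast\alpha(z)+\{x,y,z\}]=0$; (SHLY6) $\circlearrowleft_{(x,y,z)}(-1)^{|x||z|}\{x\ast y,\alpha(z),\alpha(u)\}=0$; (SHLY7) $\{\alpha(x),\alpha(y),u\ast v\}=\{x,y,u\}\ast\alpha^2(v)+(-1)^{|u|(|x|+|y|)}\alpha^2(u)\ast\{x,y,v\}$; (SHLY8) $\{\alpha^2(x),\alpha^2(y),\{u,v,w\}\}=\{\{x,y,u\},\alpha^2(v),\alpha^2(w)\}+(-1)^{|u|(|x|+|y|)}\{\alpha^2(u),\{x,y,v\},\alpha^2(w)\}+(-1)^{(|x|+|y|)(|u|+|v|)}\{\alpha^2(u),\alpha^2(v),\{x,y,w\}\}$.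 *)

theory Defs
  imports Main "HOL.Vector_Spaces" "HOL-Library.Z2"
begin

text \<open>
  Degrees are elements of the two-element field \<^typ>\<open>bit\<close>, so sums and products of
  degrees are computed modulo 2. The sign \<open>(-1)\<^sup>d\<close> depends only on \<open>d\<close> modulo 2.
\<close>

definition parity_sign :: "bit \<Rightarrow> 'k::ring_1" where
  "parity_sign d = (if d = 0 then 1 else - 1)"

text \<open>The underlying space is the whole type \<open>'a\<close>; \<open>G d\<close> is its homogeneous component of
  degree \<open>d\<close>, and \<open>direct_sum\<close> says that the space is the direct sum of \<open>G 0\<close> and \<open>G 1\<close>.\<close>

locale vector_superspace = vector_space scale
  for scale :: "'k::field \<Rightarrow> 'a::ab_group_add \<Rightarrow> 'a" (infixr "*s" 75) +
  fixes G :: "bit \<Rightarrow> 'a set"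
  assumes subspace_component: "subspace (G d)"
    and direct_sum: "\<exists>!(x0, x1). x0 \<in> G 0 \<and> x1 \<in> G 1 \<and> x = x0 + x1"

locale even_linear_map = vector_superspace scale G + Vector_Spaces.linear scale scale f
  for scale :: "'k::field \<Rightarrow> 'a::ab_group_add \<Rightarrow> 'a" (infixr "*s" 75)
    and G :: "bit \<Rightarrow> 'a set" and f :: "'a \<Rightarrow> 'a" +
  assumes even: "x \<in> G i \<Longrightarrow> f x \<in> G i"

locale binary_superoperation = vector_superspace scale G
  for scale :: "'k::field \<Rightarrow> 'a::ab_group_add \<Rightarrow> 'a" (infixr "*s" 75)
    and G :: "bit \<Rightarrow> 'a set" +
  fixes mul :: "'a \<Rightarrow> 'a \<Rightarrow> 'a" (infixl "\<^bold>*" 70)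
  assumes mul_linear_left: "Vector_Spaces.linear scale scale (\<lambda>x. x \<^bold>* y)"
    and mul_linear_right: "Vector_Spaces.linear scale scale (\<lambda>y. x \<^bold>* y)"
    and mul_graded: "x \<in> G i \<Longrightarrow> y \<in> G j \<Longrightarrow> x \<^bold>* y \<in> G (i + j)"

locale ternary_superoperation = vector_superspace scale G
  for scale :: "'k::field \<Rightarrow> 'a::ab_group_add \<Rightarrow> 'a" (infixr "*s" 75)
    and G :: "bit \<Rightarrow> 'a set" +
  fixes br :: "'a \<Rightarrow> 'a \<Rightarrow> 'a \<Rightarrow> 'a" ("\<lbrace>_,/ _,/ _\<rbrace>")
  assumes br_linear_1: "Vector_Spaces.linear scale scale (\<lambda>x. \<lbrace>x, y, z\<rbrace>)"
    and br_linear_2: "Vector_Spaces.linear scale scale (\<lambda>y. \<lbrace>x, y, z\<rbrace>)"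
    and br_linear_3: "Vector_Spaces.linear scale scale (\<lambda>z. \<lbrace>x, y, z\<rbrace>)"
    and br_graded: "x \<in> G i \<Longrightarrow> y \<in> G j \<Longrightarrow> z \<in> G k \<Longrightarrow> \<lbrace>x, y, z\<rbrace> \<in> G (i + j + k)"

locale even_superalgebra_endomorphism =
  binary_superoperation scale G mul + ternary_superoperation scale G br + even_linear_map scale G f
  for scale :: "'k::field \<Rightarrow> 'a::ab_group_add \<Rightarrow> 'a" (infixr "*s" 75)
    and G :: "bit \<Rightarrow> 'a set"
    and mul :: "'a \<Rightarrow> 'a \<Rightarrow> 'a" (infixl "\<^bold>*" 70)
    and br :: "'a \<Rightarrow> 'a \<Rightarrow> 'a \<Rightarrow> 'a" ("\<lbrace>_,/ _,/ _\<rbrace>")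
    and f :: "'a \<Rightarrow> 'a" +
  assumes hom_mul: "f (x \<^bold>* y) = f x \<^bold>* f y"
    and hom_br: "f \<lbrace>x, y, z\<rbrace> = \<lbrace>f x, f y, f z\<rbrace>"

text \<open>In the identities with signs, the elements \<open>x, y, z, u, v, w\<close> are homogeneous of
  degrees \<open>i, j, k, p, q, r\<close> respectively. The cyclic sums are over \<open>(x, y, z)\<close>, with the
  sign permuted along, and are written out.\<close>

locale hom_lie_yamaguti_superalgebra =
  binary_superoperation scale G mul + ternary_superoperation scale G br + even_linear_map scale G \<alpha>
  for scale :: "'k::field \<Rightarrow> 'a::ab_group_add \<Rightarrow> 'a" (infixr "*s" 75)
    and G :: "bit \<Rightarrow> 'a set"
    and mul :: "'a \<Rightarrow> 'a \<Rightarrow> 'a" (infixl "\<^bold>*" 70)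
    and br :: "'a \<Rightarrow> 'a \<Rightarrow> 'a \<Rightarrow> 'a" ("\<lbrace>_,/ _,/ _\<rbrace>")
    and \<alpha> :: "'a \<Rightarrow> 'a" +
  assumes SHLY1: "\<alpha> (x \<^bold>* y) = \<alpha> x \<^bold>* \<alpha> y"
    and SHLY2: "\<alpha> \<lbrace>x, y, z\<rbrace> = \<lbrace>\<alpha> x, \<alpha> y, \<alpha> z\<rbrace>"
    and SHLY3: "\<lbrakk>x \<in> G i; y \<in> G j\<rbrakk> \<Longrightarrow> x \<^bold>* y = - (parity_sign (i * j) *s (y \<^bold>* x))"
    and SHLY4: "\<lbrakk>x \<in> G i; y \<in> G j; z \<in> G k\<rbrakk> \<Longrightarrow>
      \<lbrace>x, y, z\<rbrace> = - (parity_sign (i * j) *s \<lbrace>y, x, z\<rbrace>)"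
    and SHLY5: "\<lbrakk>x \<in> G i; y \<in> G j; z \<in> G k\<rbrakk> \<Longrightarrow>
        parity_sign (i * k) *s ((x \<^bold>* y) \<^bold>* \<alpha> z + \<lbrace>x, y, z\<rbrace>)
      + parity_sign (j * i) *s ((y \<^bold>* z) \<^bold>* \<alpha> x + \<lbrace>y, z, x\<rbrace>)
      + parity_sign (k * j) *s ((z \<^bold>* x) \<^bold>* \<alpha> y + \<lbrace>z, x, y\<rbrace>) = 0"
    and SHLY6: "\<lbrakk>x \<in> G i; y \<in> G j; z \<in> G k; u \<in> G p\<rbrakk> \<Longrightarrow>
        parity_sign (i * k) *s \<lbrace>x \<^bold>* y, \<alpha> z, \<alpha> u\<rbrace>
      + parity_sign (j * i) *s \<lbrace>y \<^bold>* z, \<alpha> x, \<alpha> u\<rbrace>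
      + parity_sign (k * j) *s \<lbrace>z \<^bold>* x, \<alpha> y, \<alpha> u\<rbrace> = 0"
    and SHLY7: "\<lbrakk>x \<in> G i; y \<in> G j; u \<in> G p; v \<in> G q\<rbrakk> \<Longrightarrow>
      \<lbrace>\<alpha> x, \<alpha> y, u \<^bold>* v\<rbrace> =
        \<lbrace>x, y, u\<rbrace> \<^bold>* (\<alpha> ^^ 2) v
      + parity_sign (p * (i + j)) *s ((\<alpha> ^^ 2) u \<^bold>* \<lbrace>x, y, v\<rbrace>)"
    and SHLY8: "\<lbrakk>x \<in> G i; y \<in> G j; u \<in> G p; v \<in> G q; w \<in> G r\<rbrakk> \<Longrightarrow>
      \<lbrace>(\<alpha> ^^ 2) x, (\<alpha> ^^ 2) y, \<lbrace>u, v, w\<rbrace>\<rbrace> =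
        \<lbrace>\<lbrace>x, y, u\<rbrace>, (\<alpha> ^^ 2) v, (\<alpha> ^^ 2) w\<rbrace>
      + parity_sign (p * (i + j)) *s \<lbrace>(\<alpha> ^^ 2) u, \<lbrace>x, y, v\<rbrace>, (\<alpha> ^^ 2) w\<rbrace>
      + parity_sign ((i + j) * (p + q)) *s \<lbrace>(\<alpha> ^^ 2) u, (\<alpha> ^^ 2) v, \<lbrace>x, y, w\<rbrace>\<rbrace>"

end

theory Submission
  imports Defs
begin

text \<open>
  The powers \<open>\<beta>\<^sup>n\<close> are again even endomorphisms commuting with \<open>\<alpha>\<close>
  (\<open>even_superalgebra_endomorphism_funpow\<close>), so it suffices to twist once, by a single such
  endomorphism \<open>\<gamma>\<close> (\<open>hom_lie_yamaguti_twist\<close>): \<open>x *\<^sub>\<gamma> y = \<gamma> (x * y)\<close>,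
  \<open>{x, y, z}\<^sub>\<gamma> = \<gamma>\<^sup>2 {x, y, z}\<close>, twisting map \<open>\<gamma>\<alpha>\<close>.

  Twisting works because of a weight count. Give \<open>*\<close> the weight \<open>1\<close>, the ternary bracket \<open>2\<close> and
  \<open>\<alpha>\<close> \<open>1\<close>. In each term of an identity, the weights of the operations met on the way from the
  outermost one down to a variable have the same sum for every variable, and this sum is common
  to all terms of the identity. Hence, by multiplicativity and by commutation with \<open>\<alpha>\<close>, all
  the \<open>\<gamma>\<close> in the twisted identity can be moved to the outside of each term, where they form
  the power of \<open>\<gamma>\<close> given by that sum. The power
  is \<open>1\<close> in (SHLY3), \<open>2\<close> in (SHLY1), (SHLY4) and (SHLY5), \<open>3\<close> in (SHLY2), (SHLY6) and (SHLY7),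
  and \<open>4\<close> in (SHLY8). Since \<open>\<gamma>\<close> is linear, each identity of the twist is the image of the
  original identity under that power. For example, in (SHLY7) the left side becomes
  \<open>\<gamma>\<^sup>2 {\<gamma>\<alpha>x, \<gamma>\<alpha>y, \<gamma>(u * v)} = \<gamma>\<^sup>3 {\<alpha>x, \<alpha>y, u * v}\<close>, and the first term on the right becomes
  \<open>\<gamma> (\<gamma>\<^sup>2 {x, y, u} * \<gamma>\<^sup>2 \<alpha>\<^sup>2 v) = \<gamma>\<^sup>3 ({x, y, u} * \<alpha>\<^sup>2 v)\<close>.
\<close>

lemma even_superalgebra_endomorphism_id:
  assumes "even_superalgebra_endomorphism scale G mul br f"
  shows "even_superalgebra_endomorphism scale G mul br id"
proof -
  interpret E: even_superalgebra_endomorphism scale G mul br f by fact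
  show ?thesis
    by unfold_locales auto
qed

lemma even_superalgebra_endomorphism_comp:
  assumes "even_superalgebra_endomorphism scale G mul br f"
    and "even_superalgebra_endomorphism scale G mul br g"
  shows "even_superalgebra_endomorphism scale G mul br (f \<circ> g)"
proof -
  interpret F: even_superalgebra_endomorphism scale G mul br f by fact
  interpret H: even_superalgebra_endomorphism scale G mul br g by fact
  show ?thesis
    by unfold_locales
      (simp_all add: F.add H.add F.scale H.scale F.even H.even F.hom_mul H.hom_mul F.hom_br H.hom_br)
qed

lemma even_superalgebra_endomorphism_funpow:
  assumes "even_superalgebra_endomorphism scale G mul br f"
  shows "even_superalgebra_endomorphism scale G mul br (f ^^ n)"
proof (induction n)
  case 0
  show ?case
    using even_superalgebra_endomorphism_id[OF assms] by (simp add: id_def)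
next
  case (Suc n)
  then show ?case
    using even_superalgebra_endomorphism_comp[OF assms] by (simp only: funpow.simps)
qed

text \<open>
  For each signed identity the original instance is first transported by the power of \<open>f\<close>
  given by its weight; distributing that power over sums, scalars and both operations then
  gives the twisted identity.
\<close>

lemma hom_lie_yamaguti_twist:
  fixes scale :: "'k::field \<Rightarrow> 'a::ab_group_add \<Rightarrow> 'a"
  assumes "hom_lie_yamaguti_superalgebra scale G mul br \<alpha>"
    and "even_superalgebra_endomorphism scale G mul br f"
    and comm: "f \<circ> \<alpha> = \<alpha> \<circ> f"
  shows "hom_lie_yamaguti_superalgebra scale G
           (\<lambda>x y. f (mul x y)) (\<lambda>x y z. (f ^^ 2) (br x y z)) (f \<circ> \<alpha>)"
proof -
  interpret A: hom_lie_yamaguti_superalgebra scale G mul br \<alpha> by fact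
  interpret F: even_superalgebra_endomorphism scale G mul br f by fact
  have sq: "(g ^^ 2) x = g (g x)" for g :: "'a \<Rightarrow> 'a" and x
    by (simp add: numeral_2_eq_2)
  \<comment> \<open>Oriented so that \<open>f\<close> moves inwards past \<open>\<alpha>\<close>, as it does past both operations.\<close>
  have fa: "f (\<alpha> x) = \<alpha> (f x)" for x
    using comm by (metis comp_apply)
  note push = F.add F.scale F.neg F.hom_mul F.hom_br fa A.SHLY1 A.SHLY2
  have lin: "Vector_Spaces.linear scale scale (\<lambda>x. f (g x))"
    if "Vector_Spaces.linear scale scale g" for g
    using Vector_Spaces.linear_compose[OF that F.linear_axioms] by (simp add: comp_def)
  show ?thesis
  proof (intro hom_lie_yamaguti_superalgebra.intro binary_superoperation.intro
      ternary_superoperation.intro even_linear_map.intro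
      hom_lie_yamaguti_superalgebra_axioms.intro binary_superoperation_axioms.intro
      ternary_superoperation_axioms.intro even_linear_map_axioms.intro
      A.vector_superspace_axioms)
    fix x y z u v w i j k p q r
    show "Vector_Spaces.linear scale scale (\<lambda>x. f (mul x y))"
      and "Vector_Spaces.linear scale scale (\<lambda>y. f (mul x y))"
      by (intro lin A.mul_linear_left A.mul_linear_right)+
    show "Vector_Spaces.linear scale scale (\<lambda>x. (f ^^ 2) (br x y z))"
      and "Vector_Spaces.linear scale scale (\<lambda>y. (f ^^ 2) (br x y z))"
      and "Vector_Spaces.linear scale scale (\<lambda>z. (f ^^ 2) (br x y z))"
      unfolding sq by (intro lin A.br_linear_1 A.br_linear_2 A.br_linear_3)+
    show "Vector_Spaces.linear scale scale (f \<circ> \<alpha>)"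
      by (rule Vector_Spaces.linear_compose[OF A.linear_axioms F.linear_axioms])
    show "(f \<circ> \<alpha>) (f (mul x y)) = f (mul ((f \<circ> \<alpha>) x) ((f \<circ> \<alpha>) y))"
      and "(f \<circ> \<alpha>) ((f ^^ 2) (br x y z)) =
        (f ^^ 2) (br ((f \<circ> \<alpha>) x) ((f \<circ> \<alpha>) y) ((f \<circ> \<alpha>) z))"
      by (simp_all add: sq push)
    assume x: "x \<in> G i"
    then show "(f \<circ> \<alpha>) x \<in> G i"
      by (simp add: A.even F.even)
    assume y: "y \<in> G j"
    show "f (mul x y) \<in> G (i + j)"
      using x y by (intro F.even A.mul_graded)
    show "f (mul x y) = - scale (parity_sign (i * j)) (f (mul y x))"
      using arg_cong[OF A.SHLY3[OF x y], of f] by (simp only: F.neg F.scale)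
    {
      assume z: "z \<in> G k"
      show "(f ^^ 2) (br x y z) \<in> G (i + j + k)"
        unfolding sq using x y z by (intro F.even A.br_graded)
      show "(f ^^ 2) (br x y z) = - scale (parity_sign (i * j)) ((f ^^ 2) (br y x z))"
        using arg_cong[OF A.SHLY4[OF x y z], of "\<lambda>t. f (f t)"] by (simp only: sq F.neg F.scale)
      show "scale (parity_sign (i * k))
              (f (mul (f (mul x y)) ((f \<circ> \<alpha>) z)) + (f ^^ 2) (br x y z))
          + scale (parity_sign (j * i))
              (f (mul (f (mul y z)) ((f \<circ> \<alpha>) x)) + (f ^^ 2) (br y z x))
          + scale (parity_sign (k * j))
              (f (mul (f (mul z x)) ((f \<circ> \<alpha>) y)) + (f ^^ 2) (br z x y)) = 0"
        using arg_cong[OF A.SHLY5[OF x y z], of "\<lambda>t. f (f t)"]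
        by (simp only: sq push comp_apply F.zero)
      assume u: "u \<in> G p"
      show "scale (parity_sign (i * k))
              ((f ^^ 2) (br (f (mul x y)) ((f \<circ> \<alpha>) z) ((f \<circ> \<alpha>) u)))
          + scale (parity_sign (j * i))
              ((f ^^ 2) (br (f (mul y z)) ((f \<circ> \<alpha>) x) ((f \<circ> \<alpha>) u)))
          + scale (parity_sign (k * j))
              ((f ^^ 2) (br (f (mul z x)) ((f \<circ> \<alpha>) y) ((f \<circ> \<alpha>) u))) = 0"
        using arg_cong[OF A.SHLY6[OF x y z u], of "\<lambda>t. f (f (f t))"]
        by (simp only: sq push comp_apply F.zero)
    }
    assume u: "u \<in> G p" and v: "v \<in> G q"
    show "(f ^^ 2) (br ((f \<circ> \<alpha>) x) ((f \<circ> \<alpha>) y) (f (mul u v))) =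
            f (mul ((f ^^ 2) (br x y u)) (((f \<circ> \<alpha>) ^^ 2) v))
          + scale (parity_sign (p * (i + j)))
              (f (mul (((f \<circ> \<alpha>) ^^ 2) u) ((f ^^ 2) (br x y v))))"
      using arg_cong[OF A.SHLY7[OF x y u v], of "\<lambda>t. f (f (f t))"]
      by (simp only: sq push comp_apply)
    assume w: "w \<in> G r"
    show "(f ^^ 2) (br (((f \<circ> \<alpha>) ^^ 2) x) (((f \<circ> \<alpha>) ^^ 2) y) ((f ^^ 2) (br u v w))) =
            (f ^^ 2) (br ((f ^^ 2) (br x y u)) (((f \<circ> \<alpha>) ^^ 2) v) (((f \<circ> \<alpha>) ^^ 2) w))
          + scale (parity_sign (p * (i + j)))
              ((f ^^ 2) (br (((f \<circ> \<alpha>) ^^ 2) u) ((f ^^ 2) (br x y v)) (((f \<circ> \<alpha>) ^^ 2) w)))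
          + scale (parity_sign ((i + j) * (p + q)))
              ((f ^^ 2) (br (((f \<circ> \<alpha>) ^^ 2) u) (((f \<circ> \<alpha>) ^^ 2) v) ((f ^^ 2) (br x y w))))"
      using arg_cong[OF A.SHLY8[OF x y u v w], of "\<lambda>t. f (f (f (f t)))"]
      by (simp only: sq push comp_apply)
  qed
qed

theorem theorem3p10:
  fixes scale :: "'k::field \<Rightarrow> 'a::ab_group_add \<Rightarrow> 'a"
    and G :: "bit \<Rightarrow> 'a set"
    and mul :: "'a \<Rightarrow> 'a \<Rightarrow> 'a"
    and br :: "'a \<Rightarrow> 'a \<Rightarrow> 'a \<Rightarrow> 'a"
    and \<alpha> \<beta> :: "'a \<Rightarrow> 'a"
    and n :: nat
  assumes "hom_lie_yamaguti_superalgebra scale G mul br \<alpha>"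
    and "even_superalgebra_endomorphism scale G mul br \<beta>"
    and "\<beta> \<circ> \<alpha> = \<alpha> \<circ> \<beta>"
    and "n \<ge> 1"
  shows "hom_lie_yamaguti_superalgebra scale G
           (\<lambda>x y. (\<beta> ^^ n) (mul x y))
           (\<lambda>x y z. (\<beta> ^^ (2 * n)) (br x y z))
           ((\<beta> ^^ n) \<circ> \<alpha>)"
proof -
  have comm: "\<beta> ^^ n \<circ> \<alpha> = \<alpha> \<circ> \<beta> ^^ n"
  proof (induction n)
    case (Suc n)
    then show ?case
      using assms(3) by (metis comp_assoc funpow.simps(2))
  qed simp
  have "(\<beta> ^^ n) ^^ 2 = \<beta> ^^ (2 * n)"
    by (simp add: funpow_mult mult.commute)
  then show ?thesis
    using hom_lie_yamaguti_twist[OF assms(1) even_superalgebra_endomorphism_funpow[OF assms(2)] comm]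
    by simp
qed

end
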